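(* Let $n\ge 3$ be an integer. A theory $T$ is $\mathrm{NSOP}_n$ if and only if, for any definable relation $R(x,y)$ with a sequence $\{a_i\}_{i<\omega}$ such that $\models R(a_i,a_j)$ for $i<j$, and for all $N<\omega$, there exist $b_0,\ldots,b_{N-1}$ such that, for all integers $i,j$ with $0\le i<N$ and $1\le j\le \frac{N}{n}$, $\models R(b_i,b_{(i+j)\bmod N})$.
   Context: $T$ is a (complete) first-order theory; $\models$ and all elements refer to a sufficiently saturated (monster) model of $T$; $R(x,y)$ is a definable relation where $x,y$ are finite tuples of variables of the same length, and the $a_i,b_i$ are tuples of that length. For an integer $n\ge 3$, $T$ is $\mathrm{NSOP}_n$ (Shelah's definition) if there is no definable relation $R(x,y)$ such that there exists a sequence $\{a_i\}_{i<\omega}$ with $\models R(a_i,a_j)$ for $i<j$, but there do not exist $\{a_i\}_{i=0}^{n-1}$ such that $\models R(a_i,a_{(i+1)\bmod n})$ for $0\le i\le n-1$. *)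

theory Defs
  imports Complex_Main
begin

unbundle cardinal_syntax

section \<open>First-order languages, structures and satisfaction\<close>

text \<open>A symbol is a name together with its arity. The symbols form sets rather than whole types, so
  that purely relational and purely functional languages are included.\<close>

record ('f, 'r) lang =
  Funs :: "('f \<times> nat) set"
  Rels :: "('r \<times> nat) set"

datatype 'f tm = Var nat | Fn 'f "'f tm list"

datatype ('f, 'r) fm =
    Eq "'f tm" "'f tm"
  | Rel 'r "'f tm list"
  | Neg "('f, 'r) fm"
  | Conj "('f, 'r) fm" "('f, 'r) fm"
  | Ex nat "('f, 'r) fm"

primrec wf_tm :: "('f, 'r) lang \<Rightarrow> 'f tm \<Rightarrow> bool" where
  "wf_tm L (Var x) \<longleftrightarrow> True"
| "wf_tm L (Fn f ts) \<longleftrightarrow> (f, length ts) \<in> Funs L \<and> list_all (wf_tm L) ts"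

primrec wf_fm :: "('f, 'r) lang \<Rightarrow> ('f, 'r) fm \<Rightarrow> bool" where
  "wf_fm L (Eq s t) \<longleftrightarrow> wf_tm L s \<and> wf_tm L t"
| "wf_fm L (Rel r ts) \<longleftrightarrow> (r, length ts) \<in> Rels L \<and> list_all (wf_tm L) ts"
| "wf_fm L (Neg p) \<longleftrightarrow> wf_fm L p"
| "wf_fm L (Conj p q) \<longleftrightarrow> wf_fm L p \<and> wf_fm L q"
| "wf_fm L (Ex x p) \<longleftrightarrow> wf_fm L p"

primrec fv_tm :: "'f tm \<Rightarrow> nat set" where
  "fv_tm (Var x) = {x}"
| "fv_tm (Fn f ts) = \<Union> (set (map fv_tm ts))"

primrec fv :: "('f, 'r) fm \<Rightarrow> nat set" where
  "fv (Eq s t) = fv_tm s \<union> fv_tm t"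
| "fv (Rel r ts) = \<Union> (set (map fv_tm ts))"
| "fv (Neg p) = fv p"
| "fv (Conj p q) = fv p \<union> fv q"
| "fv (Ex x p) = fv p - {x}"

definition sentence :: "('f, 'r) lang \<Rightarrow> ('f, 'r) fm \<Rightarrow> bool" where
  "sentence L p \<longleftrightarrow> wf_fm L p \<and> fv p = {}"

record ('f, 'r, 'a) struct =
  Univ :: "'a set"
  fun_of :: "'f \<Rightarrow> 'a list \<Rightarrow> 'a"
  rel_of :: "'r \<Rightarrow> 'a list \<Rightarrow> bool"

definition tuples :: "('f, 'r, 'a) struct \<Rightarrow> nat \<Rightarrow> 'a list set" where
  "tuples M m = {xs. length xs = m \<and> set xs \<subseteq> Univ M}"

text \<open>Values of \<open>fun_of\<close> and \<open>rel_of\<close> at symbols outside the language or at arguments outside the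
  universe are junk and never inspected when evaluating formulas of the language.\<close>

definition is_struct :: "('f, 'r) lang \<Rightarrow> ('f, 'r, 'a) struct \<Rightarrow> bool" where
  "is_struct L M \<longleftrightarrow> Univ M \<noteq> {} \<and> (\<forall>(f, k) \<in> Funs L. \<forall>xs \<in> tuples M k. fun_of M f xs \<in> Univ M)"

primrec eval_tm :: "('f, 'r, 'a) struct \<Rightarrow> (nat \<Rightarrow> 'a) \<Rightarrow> 'f tm \<Rightarrow> 'a" where
  "eval_tm M v (Var x) = v x"
| "eval_tm M v (Fn f ts) = fun_of M f (map (eval_tm M v) ts)"

primrec sat :: "('f, 'r, 'a) struct \<Rightarrow> (nat \<Rightarrow> 'a) \<Rightarrow> ('f, 'r) fm \<Rightarrow> bool" where
  "sat M v (Eq s t) \<longleftrightarrow> eval_tm M v s = eval_tm M v t"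
| "sat M v (Rel r ts) \<longleftrightarrow> rel_of M r (map (eval_tm M v) ts)"
| "sat M v (Neg p) \<longleftrightarrow> \<not> sat M v p"
| "sat M v (Conj p q) \<longleftrightarrow> sat M v p \<and> sat M v q"
| "sat M v (Ex x p) \<longleftrightarrow> (\<exists>a \<in> Univ M. sat M (v(x := a)) p)"

definition models :: "('f, 'r) lang \<Rightarrow> ('f, 'r, 'a) struct \<Rightarrow> ('f, 'r) fm set \<Rightarrow> bool" where
  "models L M T \<longleftrightarrow> is_struct L M \<and> (\<forall>p \<in> T. \<forall>v. range v \<subseteq> Univ M \<longrightarrow> sat M v p)"

section \<open>Complete theories\<close>

text \<open>HOL cannot quantify over structures of all types. Here the universes range over the subsets of
  the type of formulas; by the downward Loewenheim-Skolem theorem this is enough to decide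
  satisfiability and consequence for sets of sentences over these symbols.\<close>

definition satisfiable :: "('f, 'r) lang \<Rightarrow> ('f, 'r) fm set \<Rightarrow> bool" where
  "satisfiable L T \<longleftrightarrow> (\<exists>M :: ('f, 'r, ('f, 'r) fm) struct. models L M T)"

definition entails :: "('f, 'r) lang \<Rightarrow> ('f, 'r) fm set \<Rightarrow> ('f, 'r) fm \<Rightarrow> bool" where
  "entails L T p \<longleftrightarrow> (\<forall>M :: ('f, 'r, ('f, 'r) fm) struct. models L M T \<longrightarrow> models L M {p})"

definition complete_theory :: "('f, 'r) lang \<Rightarrow> ('f, 'r) fm set \<Rightarrow> bool" where
  "complete_theory L T \<longleftrightarrow>
     (\<forall>p \<in> T. sentence L p) \<and> satisfiable L T \<and>
     (\<forall>p. sentence L p \<longrightarrow> entails L T p \<or> entails L T (Neg p))"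

section \<open>Monster models\<close>

text \<open>\<open>\<kappa>\<close>-saturation: every finitely satisfiable set of formulas in one variable over fewer than \<open>\<kappa>\<close>
  parameters is realised. A formula over \<open>A\<close> in one variable is a pair \<open>(p, cs)\<close>: variable \<open>0\<close> is the
  free variable and variable \<open>Suc i\<close> stands for the parameter \<open>cs ! i\<close>.\<close>

definition saturated :: "'k rel \<Rightarrow> ('f, 'r) lang \<Rightarrow> ('f, 'r, 'a) struct \<Rightarrow> bool" where
  "saturated \<kappa> L M \<longleftrightarrow>
     (\<forall>A (\<Gamma> :: (('f, 'r) fm \<times> 'a list) set).
        A \<subseteq> Univ M \<longrightarrow> ( |A| <o \<kappa> ) \<longrightarrow>
        (\<forall>(p, cs) \<in> \<Gamma>. wf_fm L p \<and> set cs \<subseteq> A \<and> fv p \<subseteq> {..<Suc (length cs)}) \<longrightarrow>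
        (\<forall>F. finite F \<longrightarrow> F \<subseteq> \<Gamma> \<longrightarrow> (\<exists>a \<in> Univ M. \<forall>(p, cs) \<in> F. sat M (nth (a # cs)) p)) \<longrightarrow>
        (\<exists>a \<in> Univ M. \<forall>(p, cs) \<in> \<Gamma>. sat M (nth (a # cs)) p))"

text \<open>The set of all \<open>L\<close>-formulas has cardinality \<open>|L| + \<aleph>\<^sub>0\<close>.\<close>

definition monster :: "'k rel \<Rightarrow> ('f, 'r) lang \<Rightarrow> ('f, 'r) fm set \<Rightarrow> ('f, 'r, 'a) struct \<Rightarrow> bool" where
  "monster \<kappa> L T M \<longleftrightarrow>
     models L M T \<and> Card_order \<kappa> \<and> ( |{p. wf_fm L p}| <o \<kappa> ) \<and> saturated \<kappa> L M"

section \<open>Definable relations and \<open>NSOP\<^sub>n\<close>\<close>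

text \<open>Definable means definable with parameters from the model: variables \<open>0, \<dots>, m - 1\<close> are \<open>x\<close>,
  variables \<open>m, \<dots>, 2 m - 1\<close> are \<open>y\<close>, and the remaining ones stand for the parameters \<open>cs\<close>.\<close>

definition definable_rel ::
  "('f, 'r) lang \<Rightarrow> ('f, 'r, 'a) struct \<Rightarrow> nat \<Rightarrow> ('a list \<times> 'a list) set \<Rightarrow> bool" where
  "definable_rel L M m R \<longleftrightarrow>
     (\<exists>p cs. wf_fm L p \<and> set cs \<subseteq> Univ M \<and> fv p \<subseteq> {..<m + m + length cs} \<and>
        R = {(x, y). x \<in> tuples M m \<and> y \<in> tuples M m \<and> sat M (nth (x @ y @ cs)) p})"

text \<open>\<open>NSOP\<^sub>n\<close> for a theory, evaluated in its monster model \<open>M\<close>.\<close>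

definition NSOP :: "nat \<Rightarrow> ('f, 'r) lang \<Rightarrow> ('f, 'r, 'a) struct \<Rightarrow> bool" where
  "NSOP n L M \<longleftrightarrow>
     \<not> (\<exists>m R. definable_rel L M m R \<and>
          (\<exists>a :: nat \<Rightarrow> 'a list. (\<forall>i. a i \<in> tuples M m) \<and> (\<forall>i j. i < j \<longrightarrow> (a i, a j) \<in> R)) \<and>
          \<not> (\<exists>a :: nat \<Rightarrow> 'a list. (\<forall>i<n. a i \<in> tuples M m) \<and>
                (\<forall>i<n. (a i, a ((i + 1) mod n)) \<in> R)))"

end

theory Submission imports Defs begin

text \<open>
  The condition on \<open>b\<^sub>0, \<dots>, b\<^bsub>N-1\<^esub>\<close> for \<open>N = n\<close> only concerns \<open>j = 1\<close> and asks for an \<open>n\<close>-cycle of \<open>R\<close>,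
  so it implies \<open>NSOP\<^sub>n\<close>. For the converse the idea is to apply \<open>NSOP\<^sub>n\<close> not to \<open>R\<close> but to a
  relation between long tuples of points. Read a tuple of length \<open>N * m\<close> as a sequence of \<open>N\<close> points
  (blocks of length \<open>m\<close>), and call two such tuples \<open>x, y\<close> related if the \<open>2 N\<close> points of \<open>x @ y\<close>
  form a chain, each point being \<open>R\<close>-related to all later ones. This relation is definable
  (\<open>definable_chain_rel\<close>), and cutting an infinite \<open>R\<close>-chain into consecutive segments of \<open>N\<close> points
  gives an infinite chain for it (\<open>segments_in_chain_rel\<close>). Hence \<open>NSOP\<^sub>n\<close> yields a cycle
  \<open>c\<^sub>0, \<dots>, c\<^bsub>n-1\<^esub>\<close> of sequences of \<open>N\<close> points: \<open>R\<close> holds from earlier to later points within one \<open>c\<^sub>t\<close>,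
  and from every point of \<open>c\<^sub>t\<close> to every point of \<open>c\<^bsub>t+1\<^esub>\<close>, indices modulo \<open>n\<close>.

  Now divide the cycle \<open>{0, \<dots>, N - 1}\<close> into \<open>n\<close> arcs, \<open>i\<close> lying in the arc \<open>t i = \<lfloor>i n / N\<rfloor>\<close>, and
  let \<open>b\<^sub>i\<close> be the \<open>i\<close>-th point of \<open>c\<^bsub>t i\<^esub>\<close>. A step of length \<open>j \<le> N / n\<close> increases \<open>i n / N\<close> by at
  most \<open>1\<close>, so it either goes forward inside an arc or ends in the next arc, and \<open>R\<close> holds
  in both cases (\<open>spread_cycle\<close>).

  The syntactic ingredient, used for definability, is the substitution of variables for
  variables, with renaming of bound variables (\<open>ex_rename\<close>).
\<close>

section \<open>Renaming the variables of a formula\<close>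

lemma finite_fv_tm: "finite (fv_tm t)"
  by (induction t) auto

lemma finite_fv: "finite (fv p)"
  by (induction p) (auto simp: finite_fv_tm)

lemma eval_tm_cong: "(\<And>x. x \<in> fv_tm t \<Longrightarrow> v x = w x) \<Longrightarrow> eval_tm M v t = eval_tm M w t"
proof (induction t)
  case (Fn f ts)
  then have "map (eval_tm M v) ts = map (eval_tm M w) ts"
    by (intro map_cong refl Fn.IH) auto
  then show ?case by (simp only: eval_tm.simps)
qed simp

lemma sat_cong: "(\<And>x. x \<in> fv p \<Longrightarrow> v x = w x) \<Longrightarrow> sat M v p = sat M w p"
proof (induction p arbitrary: v w)
  case (Eq s t)
  then show ?case using eval_tm_cong[of s v w M] eval_tm_cong[of t v w M] by simp
next
  case (Rel r ts)
  then have "map (eval_tm M v) ts = map (eval_tm M w) ts"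
    by (intro map_cong refl eval_tm_cong) auto
  then show ?case by (simp only: sat.simps)
next
  case (Neg p)
  have "sat M v p = sat M w p"
    by (rule Neg.IH) (use Neg.prems in auto)
  then show ?case by simp
next
  case (Conj p q)
  have "sat M v p = sat M w p" "sat M v q = sat M w q"
    by (rule Conj.IH; use Conj.prems in auto)+
  then show ?case by simp
next
  case (Ex x p)
  have "sat M (v(x := a)) p = sat M (w(x := a)) p" for a
    by (rule Ex.IH) (use Ex.prems in auto)
  then show ?case by simp
qed

primrec rename_tm :: "(nat \<Rightarrow> nat) \<Rightarrow> 'f tm \<Rightarrow> 'f tm" where
  "rename_tm f (Var x) = Var (f x)"
| "rename_tm f (Fn g ts) = Fn g (map (rename_tm f) ts)"

lemma wf_rename_tm: "wf_tm L (rename_tm f t) = wf_tm L t"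
proof (induction t)
  case (Fn g ts)
  then have "list_all (\<lambda>t. wf_tm L (rename_tm f t)) ts = list_all (wf_tm L) ts"
    by (intro list.pred_cong) auto
  then show ?case by (simp add: list.pred_map comp_def)
qed simp

lemma fv_rename_tm: "fv_tm (rename_tm f t) = f ` fv_tm t"
  by (induction t) auto

lemma eval_rename_tm: "eval_tm M v (rename_tm f t) = eval_tm M (v \<circ> f) t"
proof (induction t)
  case (Fn g ts)
  then have "map (eval_tm M v \<circ> rename_tm f) ts = map (eval_tm M (v \<circ> f)) ts"
    by (intro map_cong) (auto simp: comp_def)
  then show ?case by (simp only: eval_tm.simps rename_tm.simps map_map)
qed simp

text \<open>Under a quantifier, the bound variable is first renamed to one outside the image of the free
  variables, so that no variable is captured. Stating this as an existence result lets the
  induction choose that variable anew at every quantifier.\<close>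

lemma ex_rename:
  fixes p :: "('f, 'r) fm" and M :: "('f, 'r, 'a) struct"
  shows "wf_fm L p \<Longrightarrow>
    \<exists>q. wf_fm L q \<and> fv q \<subseteq> f ` fv p \<and> (\<forall>v. sat M v q = sat M (v \<circ> f) p)"
proof (induction p arbitrary: f)
  case (Eq s t)
  then show ?case
    by (intro exI[of _ "Eq (rename_tm f s) (rename_tm f t)"])
      (auto simp: wf_rename_tm fv_rename_tm eval_rename_tm comp_def)
next
  case (Rel r ts)
  then have "list_all (wf_tm L \<circ> rename_tm f) ts"
    by (auto simp: list_all_iff wf_rename_tm)
  moreover have "sat M v (Rel r (map (rename_tm f) ts)) = sat M (v \<circ> f) (Rel r ts)" for v
  proof -
    have "map (eval_tm M v) (map (rename_tm f) ts) = map (eval_tm M (v \<circ> f)) ts"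
      by (simp add: eval_rename_tm)
    then show ?thesis by (simp only: sat.simps)
  qed
  ultimately show ?case using Rel
    by (intro exI[of _ "Rel r (map (rename_tm f) ts)"])
      (simp add: list.pred_map fv_rename_tm image_UN comp_def del: sat.simps)
next
  case (Neg p)
  then obtain q where "wf_fm L q" "fv q \<subseteq> f ` fv p" "\<forall>v. sat M v q = sat M (v \<circ> f) p"
    by (metis wf_fm.simps(3))
  then show ?case by (intro exI[of _ "Neg q"]) (auto simp: comp_def)
next
  case (Conj p1 p2)
  obtain q1 where "wf_fm L q1" "fv q1 \<subseteq> f ` fv p1" "\<forall>v. sat M v q1 = sat M (v \<circ> f) p1"
    using Conj by (metis wf_fm.simps(4))
  moreover obtain q2 where "wf_fm L q2" "fv q2 \<subseteq> f ` fv p2" "\<forall>v. sat M v q2 = sat M (v \<circ> f) p2"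
    using Conj by (metis wf_fm.simps(4))
  ultimately show ?case by (intro exI[of _ "Conj q1 q2"]) (auto simp: comp_def)
next
  case (Ex x p)
  obtain y where y: "y \<notin> f ` fv p"
    using ex_new_if_finite[of "f ` fv p"] finite_fv by auto
  let ?g = "f(x := y)"
  obtain q where q: "wf_fm L q" "fv q \<subseteq> ?g ` fv p" "\<forall>v. sat M v q = sat M (v \<circ> ?g) p"
    using Ex.IH[of ?g] Ex.prems unfolding wf_fm.simps by blast
  have upd: "sat M (v(y := a)) q = sat M ((v \<circ> f)(x := a)) p" for v a
  proof -
    have "sat M (v(y := a) \<circ> ?g) p = sat M ((v \<circ> f)(x := a)) p"
      by (rule sat_cong) (use y in auto)
    then show ?thesis using q(3) by simp
  qed
  have "wf_fm L (Ex y q)" using q(1) by simp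
  moreover have "fv (Ex y q) \<subseteq> f ` fv (Ex x p)" using q(2) by auto
  moreover have "sat M v (Ex y q) = sat M (v \<circ> f) (Ex x p)" for v
    by (simp only: sat.simps upd)
  ultimately show ?case by blast
qed

lemma ex_conjunction:
  fixes M :: "('f, 'r, 'a) struct"
  assumes "finite P" "P \<noteq> {}" "\<And>p. p \<in> P \<Longrightarrow> wf_fm L p \<and> fv p \<subseteq> V"
  shows "\<exists>q. wf_fm L q \<and> fv q \<subseteq> V \<and> (\<forall>v. sat M v q \<longleftrightarrow> (\<forall>p\<in>P. sat M v p))"
  using assms
proof (induction P rule: finite_ne_induct)
  case (singleton p)
  then show ?case by (intro exI[of _ p]) auto
next
  case (insert p P)
  then obtain q where "wf_fm L q" "fv q \<subseteq> V" "\<forall>v. sat M v q \<longleftrightarrow> (\<forall>p\<in>P. sat M v p)"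
    by auto
  then show ?case using insert.prems by (intro exI[of _ "Conj p q"]) auto
qed

section \<open>Chains of points inside long tuples\<close>

definition block :: "nat \<Rightarrow> 'a list \<Rightarrow> nat \<Rightarrow> 'a list" where
  "block m z k = take m (drop (k * m) z)"

definition chain_rel ::
  "('f, 'r, 'a) struct \<Rightarrow> nat \<Rightarrow> nat \<Rightarrow> ('a list \<times> 'a list) set \<Rightarrow> ('a list \<times> 'a list) set" where
  "chain_rel M m s R = {(x, y). x \<in> tuples M (s * m) \<and> y \<in> tuples M (s * m) \<and>
     (\<forall>k l. k < l \<longrightarrow> l < s + s \<longrightarrow> (block m (x @ y) k, block m (x @ y) l) \<in> R)}"

lemma block_fits:
  fixes k s m :: nat
  assumes "k < s"
  shows "k * m + m \<le> s * m"
  using mult_le_mono1[of "Suc k" s m] assms by simp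

lemma length_block: "length z = s * m \<Longrightarrow> k < s \<Longrightarrow> length (block m z k) = m"
  using block_fits[of k s m] by (simp add: block_def)

lemma nth_block: "length z = s * m \<Longrightarrow> k < s \<Longrightarrow> i < m \<Longrightarrow> block m z k ! i = z ! (k * m + i)"
  using block_fits[of k s m] by (simp add: block_def)

lemma block_in_tuples:
  assumes "z \<in> tuples M (s * m)" "k < s"
  shows "block m z k \<in> tuples M m"
  using assms length_block[of z s m k]
  by (auto simp: tuples_def block_def dest!: in_set_takeD in_set_dropD)

lemma block_append1:
  assumes "length x = s * m" "k < s"
  shows "block m (x @ y) k = block m x k"
  using assms block_fits[of k s m] by (simp add: block_def)

lemma block_append2:
  assumes "length x = s * m"
  shows "block m (x @ y) (s + k) = block m y k"
  using assms by (simp add: block_def algebra_simps)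

lemma block_concat:
  assumes "\<And>z. z \<in> set zs \<Longrightarrow> length z = m" "k < length zs"
  shows "block m (concat zs) k = zs ! k"
  using assms
proof (induction zs arbitrary: k)
  case (Cons z zs)
  then show ?case by (cases k) (auto simp: block_def)
qed simp

text \<open>The renaming sends the variables of \<open>R(x, y)\<close> to those of the \<open>k\<close>-th and the \<open>l\<close>-th block and
  moves the parameters behind all \<open>s + s\<close> blocks; the relation is then the conjunction over the
  finitely many pairs \<open>k < l < s + s\<close>, of which \<open>s \<ge> 1\<close> guarantees at least one.\<close>

lemma definable_chain_rel:
  fixes M :: "('f, 'r, 'a) struct"
  assumes "definable_rel L M m R" "s \<ge> 1"
  shows "definable_rel L M (s * m) (chain_rel M m s R)"
proof -
  obtain p cs where p: "wf_fm L p" "set cs \<subseteq> Univ M" "fv p \<subseteq> {..<m + m + length cs}"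
    and R: "R = {(x, y). x \<in> tuples M m \<and> y \<in> tuples M m \<and> sat M (nth (x @ y @ cs)) p}"
    using assms(1) unfolding definable_rel_def by blast
  define f where "f k l v = (if v < m then k * m + v else if v < m + m then l * m + (v - m)
      else (s + s) * m + (v - (m + m)))" for k l v
  have "\<exists>q. wf_fm L q \<and> fv q \<subseteq> f k l ` fv p \<and> (\<forall>v. sat M v q = sat M (v \<circ> f k l) p)" for k l
    using p(1) by (rule ex_rename)
  then obtain Q where Q: "\<And>k l. wf_fm L (Q k l)" "\<And>k l. fv (Q k l) \<subseteq> f k l ` fv p"
    "\<And>k l v. sat M v (Q k l) = sat M (v \<circ> f k l) p"
    by metis
  define I where "I = {(k, l). k < l \<and> l < s + s}"
  define V where "V = {..<s * m + s * m + length cs}"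
  have "I \<subseteq> {..<s + s} \<times> {..<s + s}" by (auto simp: I_def)
  then have "finite I" by (rule finite_subset) simp
  moreover have "(0, 1) \<in> I" using assms(2) by (auto simp: I_def)
  moreover have "fv (Q k l) \<subseteq> V" if "(k, l) \<in> I" for k l
  proof -
    have kl: "k < s + s" "l < s + s" using that by (auto simp: I_def)
    have "f k l v \<in> V" if "v < m + m + length cs" for v
      using that block_fits[OF kl(1), of m] block_fits[OF kl(2), of m]
      by (auto simp: f_def V_def algebra_simps)
    then show ?thesis using Q(2)[of k l] p(3) by blast
  qed
  ultimately have "\<exists>q. wf_fm L q \<and> fv q \<subseteq> V \<and>
      (\<forall>v. sat M v q \<longleftrightarrow> (\<forall>p \<in> case_prod Q ` I. sat M v p))"
    by (intro ex_conjunction) (auto simp: Q(1))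
  then obtain q where q: "wf_fm L q" "fv q \<subseteq> V"
    "\<And>v. sat M v q \<longleftrightarrow> (\<forall>p \<in> case_prod Q ` I. sat M v p)"
    by blast
  have pair: "sat M (nth (x @ y @ cs)) (Q k l) \<longleftrightarrow> (block m (x @ y) k, block m (x @ y) l) \<in> R"
    if "x \<in> tuples M (s * m)" "y \<in> tuples M (s * m)" "(k, l) \<in> I" for x y k l
  proof -
    have kl: "k < s + s" "l < s + s" using that by (auto simp: I_def)
    let ?z = "x @ y"
    have z: "?z \<in> tuples M ((s + s) * m)"
      using that by (auto simp: tuples_def algebra_simps)
    then have len: "length ?z = (s + s) * m" by (simp add: tuples_def)
    have "nth (x @ y @ cs) (f k l v) = nth (block m ?z k @ block m ?z l @ cs) v" for v
    proof -
      consider "v < m" | "m \<le> v" "v < m + m" | "m + m \<le> v" by linarith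
      then show ?thesis
      proof cases
        case 1
        then have "f k l v < length ?z"
          using block_fits[OF kl(1), of m] len by (simp add: f_def)
        then have "((x @ y) @ cs) ! f k l v = ?z ! (k * m + v)"
          using 1 by (simp only: nth_append_left) (simp add: f_def)
        then show ?thesis using 1 length_block[OF len kl(1)] nth_block[OF len kl(1) 1]
          by (simp add: nth_append)
      next
        case 2
        then have v: "v - m < m" by simp
        from 2 have "f k l v < length ?z"
          using block_fits[OF kl(2), of m] len by (simp add: f_def)
        then have "((x @ y) @ cs) ! f k l v = ?z ! (l * m + (v - m))"
          using 2 by (simp only: nth_append_left) (simp add: f_def)
        then show ?thesis using 2 length_block[OF len kl(1)] length_block[OF len kl(2)]
            nth_block[OF len kl(2) v] v
          by (simp add: nth_append)
      next
        case 3
        then have "f k l v = length ?z + (v - (m + m))"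
          using len by (simp add: f_def)
        then have "((x @ y) @ cs) ! f k l v = cs ! (v - (m + m))"
          by (simp only: nth_append_length_plus)
        moreover have "m \<le> v" "m \<le> v - m" using 3 by simp_all
        ultimately show ?thesis using 3 length_block[OF len kl(1)] length_block[OF len kl(2)]
          by (simp add: nth_append)
      qed
    qed
    then have "nth (x @ y @ cs) \<circ> f k l = nth (block m ?z k @ block m ?z l @ cs)"
      by auto
    then show ?thesis using Q(3) block_in_tuples[OF z kl(1)] block_in_tuples[OF z kl(2)]
      by (simp add: R)
  qed
  have "sat M (nth (x @ y @ cs)) q \<longleftrightarrow>
      (\<forall>k l. k < l \<longrightarrow> l < s + s \<longrightarrow> (block m (x @ y) k, block m (x @ y) l) \<in> R)"
    if "x \<in> tuples M (s * m)" "y \<in> tuples M (s * m)" for x y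
    using pair[OF that] by (auto simp: q(3) I_def)
  then have "chain_rel M m s R = {(x, y). x \<in> tuples M (s * m) \<and> y \<in> tuples M (s * m) \<and>
      sat M (nth (x @ y @ cs)) q}"
    unfolding chain_rel_def by blast
  then show ?thesis
    unfolding definable_rel_def using q(1,2) p(2) V_def by blast
qed

lemma segments_in_chain_rel:
  fixes s :: nat
  assumes a: "\<And>i. a i \<in> tuples M m" "\<And>i j. i < j \<Longrightarrow> (a i, a j) \<in> R"
  defines "A \<equiv> \<lambda>i. concat (map a [i * s..<i * s + s])"
  shows "A i \<in> tuples M (s * m)" and "i < j \<Longrightarrow> (A i, A j) \<in> chain_rel M m s R"
proof -
  have len: "length (a i) = m" for i using a(1) by (simp add: tuples_def)
  show A: "A i \<in> tuples M (s * m)" for i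
  proof -
    have "map (length \<circ> a) [i * s..<i * s + s] = map (\<lambda>_. m) [i * s..<i * s + s]"
      by (simp add: len)
    then have "length (A i) = s * m"
      by (simp only: A_def length_concat map_map) (simp add: sum_list_triv)
    then show ?thesis using a(1) by (fastforce simp: tuples_def A_def)
  qed
  show "(A i, A j) \<in> chain_rel M m s R" if "i < j"
  proof -
    let ?is = "[i * s..<i * s + s] @ [j * s..<j * s + s]"
    have "sorted_wrt (<) ?is"
      using block_fits[OF that, of s] by (auto simp: sorted_wrt_append)
    then have "?is ! k < ?is ! l" if "k < l" "l < s + s" for k l
      using that by (intro sorted_wrt_nth_less[of "(<)"]) auto
    moreover have "block m (A i @ A j) k = a (?is ! k)" if "k < s + s" for k
    proof -
      have "block m (concat (map a ?is)) k = map a ?is ! k"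
        by (rule block_concat) (use that len in auto)
      also have "\<dots> = a (?is ! k)" by (rule nth_map) (use that in simp)
      finally show ?thesis by (simp add: A_def)
    qed
    ultimately show ?thesis
      unfolding chain_rel_def using A a(2) by auto
  qed
qed

section \<open>Spreading a cycle of chains over \<open>N\<close> points\<close>

text \<open>The \<open>i\<close>-th point is taken at place \<open>i\<close> of its chain, rather than at the place of \<open>i\<close> within
  its arc: all pairs of points in neighbouring chains are related, so only the order of the places
  matters, and no bookkeeping of the unequal arc lengths is needed.\<close>

lemma spread_cycle:
  fixes n N :: nat
  assumes "n \<ge> 1" "N \<ge> 1"
    and c: "\<And>t. t < n \<Longrightarrow> (c t, c ((t + 1) mod n)) \<in> chain_rel M m N R"
  defines "b \<equiv> \<lambda>i. block m (c (i * n div N)) i"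
  shows "i < N \<Longrightarrow> b i \<in> tuples M m"
    and "i < N \<Longrightarrow> 1 \<le> j \<Longrightarrow> j * n \<le> N \<Longrightarrow> (b i, b ((i + j) mod N)) \<in> R"
proof -
  have ct: "c t \<in> tuples M (N * m)" if "t < n" for t
    using c[OF that] by (simp add: chain_rel_def)
  have arc: "i * n div N < n" if "i < N" for i
    using that assms(1) by (simp add: div_less_iff_less_mult)
  show "b i \<in> tuples M m" if "i < N"
    unfolding b_def using block_in_tuples[OF ct[OF arc[OF that]] that] .
  have same: "(block m (c t) k, block m (c t) l) \<in> R" if "t < n" "k < l" "l < N" for t k l
  proof -
    let ?z = "c t @ c ((t + 1) mod n)"
    have "(block m ?z k, block m ?z l) \<in> R"
      using c[OF that(1)] that by (simp add: chain_rel_def)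
    moreover have "length (c t) = N * m" using ct[OF that(1)] by (simp add: tuples_def)
    ultimately show ?thesis using that block_append1[of "c t" N m] by simp
  qed
  have succ: "(block m (c t) k, block m (c ((t + 1) mod n)) l) \<in> R" if "t < n" "k < N" "l < N"
    for t k l
  proof -
    let ?z = "c t @ c ((t + 1) mod n)"
    have "(block m ?z k, block m ?z (N + l)) \<in> R"
      using c[OF that(1)] that by (simp add: chain_rel_def)
    moreover have "length (c t) = N * m" using ct[OF that(1)] by (simp add: tuples_def)
    ultimately show ?thesis
      using that block_append1[of "c t" N m] block_append2[of "c t" N m] by simp
  qed
  show "(b i, b ((i + j) mod N)) \<in> R" if "i < N" "1 \<le> j" "j * n \<le> N"
  proof -
    define t where "t = i * n div N"
    have t: "t < n" using arc[OF that(1)] by (simp add: t_def)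
    define u where "u = (i + j) * n div N"
    have "u \<le> (i * n + N) div N"
      unfolding u_def using that(3) by (intro div_le_mono) (simp add: algebra_simps)
    then have u_le: "u \<le> t + 1" using assms(2) by (simp add: t_def)
    have u_ge: "t \<le> u" unfolding t_def u_def by (intro div_le_mono) simp
    \<comment> \<open>The arc number of \<open>i + j\<close> is taken before reducing modulo \<open>N\<close>; passing the end of the
      cycle lowers it by exactly \<open>n\<close>.\<close>
    have u_mod: "((i + j) mod N) * n div N = u mod n" (is "?l = _")
    proof -
      have "(i + j) * n = (((i + j) div N) * N + (i + j) mod N) * n" by simp
      also have "\<dots> = ((i + j) mod N) * n + N * (((i + j) div N) * n)"
        by (simp only: add_mult_distrib add_mult_distrib2 mult_ac add_ac)
      finally have "(i + j) * n = ((i + j) mod N) * n + N * (((i + j) div N) * n)" .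
      then have "u = ((i + j) div N) * n + ?l"
        unfolding u_def using assms(2) by simp
      moreover have "?l < n" using arc assms(2) by simp
      ultimately show ?thesis by simp
    qed
    have l: "(i + j) mod N < N" using assms(2) by simp
    show ?thesis
    proof (cases "u = t")
      case True
      have "i + j < N"
      proof (rule ccontr)
        assume "\<not> i + j < N"
        then have "N * n div N \<le> u" unfolding u_def by (intro div_le_mono mult_le_mono1) simp
        then show False using t True assms(2) by simp
      qed
      then show ?thesis
        using same[OF t, of i "i + j"] that(2) u_mod t True by (simp add: b_def t_def)
    next
      case False
      then have "u = t + 1" using u_le u_ge by simp
      then show ?thesis using succ[OF t that(1) l] u_mod by (simp add: b_def t_def)
    qed
  qed
qed

section \<open>Cyclic characterisation of \<open>NSOP\<^sub>n\<close>\<close>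

lemma NSOP_cycle:
  fixes M :: "('f, 'r, 'a) struct" and a :: "nat \<Rightarrow> 'a list"
  assumes "NSOP n L M" "definable_rel L M m R"
    and "\<And>i. a i \<in> tuples M m" "\<And>i j. i < j \<Longrightarrow> (a i, a j) \<in> R"
  obtains c where "\<forall>i<n. (c i, c ((i + 1) mod n)) \<in> R"
proof -
  have "\<exists>a :: nat \<Rightarrow> 'a list. (\<forall>i. a i \<in> tuples M m) \<and> (\<forall>i j. i < j \<longrightarrow> (a i, a j) \<in> R)"
    using assms(3,4) by (intro exI[of _ a]) simp
  then show ?thesis
    using assms(1,2) that unfolding NSOP_def by blast
qed

theorem mainTheorem3:
  fixes n :: nat
    and L :: "('f, 'r) lang"
    and T :: "('f, 'r) fm set"
    and M :: "('f, 'r, 'a) struct"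
    and \<kappa> :: "'k rel"
  assumes "n \<ge> 3"
    and "complete_theory L T"
    and "monster \<kappa> L T M"
  shows "NSOP n L M \<longleftrightarrow>
    (\<forall>m R. definable_rel L M m R \<longrightarrow>
       (\<exists>a :: nat \<Rightarrow> 'a list. (\<forall>i. a i \<in> tuples M m) \<and> (\<forall>i j. i < j \<longrightarrow> (a i, a j) \<in> R)) \<longrightarrow>
       (\<forall>N :: nat. \<exists>b :: nat \<Rightarrow> 'a list. (\<forall>i<N. b i \<in> tuples M m) \<and>
          (\<forall>i j :: nat. i < N \<longrightarrow> 1 \<le> j \<longrightarrow> real j \<le> real N / real n \<longrightarrow>
             (b i, b ((i + j) mod N)) \<in> R)))"
proof
  assume nsop: "NSOP n L M"
  show "\<forall>m R. definable_rel L M m R \<longrightarrow>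
       (\<exists>a :: nat \<Rightarrow> 'a list. (\<forall>i. a i \<in> tuples M m) \<and> (\<forall>i j. i < j \<longrightarrow> (a i, a j) \<in> R)) \<longrightarrow>
       (\<forall>N :: nat. \<exists>b :: nat \<Rightarrow> 'a list. (\<forall>i<N. b i \<in> tuples M m) \<and>
          (\<forall>i j :: nat. i < N \<longrightarrow> 1 \<le> j \<longrightarrow> real j \<le> real N / real n \<longrightarrow>
             (b i, b ((i + j) mod N)) \<in> R))"
  proof (intro allI impI, elim exE conjE)
    fix m R N and a :: "nat \<Rightarrow> 'a list"
    assume R: "definable_rel L M m R"
      and a: "\<forall>i. a i \<in> tuples M m" "\<forall>i j. i < j \<longrightarrow> (a i, a j) \<in> R"
    show "\<exists>b. (\<forall>i<N. b i \<in> tuples M m) \<and>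
          (\<forall>i j :: nat. i < N \<longrightarrow> 1 \<le> j \<longrightarrow> real j \<le> real N / real n \<longrightarrow>
             (b i, b ((i + j) mod N)) \<in> R)"
    proof (cases "N = 0")
      case False
      then have N: "N \<ge> 1" by simp
      define A where "A i = concat (map a [i * N..<i * N + N])" for i
      have "A i \<in> tuples M (N * m)" "i < j \<Longrightarrow> (A i, A j) \<in> chain_rel M m N R" for i j
        unfolding A_def using segments_in_chain_rel[of a M m R] a by simp_all
      then obtain c where c: "\<forall>t<n. (c t, c ((t + 1) mod n)) \<in> chain_rel M m N R"
        using NSOP_cycle[OF nsop definable_chain_rel[OF R N], of A] by blast
      have n: "n \<ge> 1" using assms(1) by simp
      have "j * n \<le> N" if "real j \<le> real N / real n" for j
      proof -
        have "real (j * n) \<le> real N" using that n by (simp add: field_simps)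
        then show ?thesis by (simp only: of_nat_le_iff)
      qed
      then show ?thesis
        using spread_cycle[OF n N, of c M m R] c
        by (intro exI[of _ "\<lambda>i. block m (c (i * n div N)) i"]) auto
    qed simp
  qed
next
  assume cyc: "\<forall>m R. definable_rel L M m R \<longrightarrow>
       (\<exists>a :: nat \<Rightarrow> 'a list. (\<forall>i. a i \<in> tuples M m) \<and> (\<forall>i j. i < j \<longrightarrow> (a i, a j) \<in> R)) \<longrightarrow>
       (\<forall>N :: nat. \<exists>b :: nat \<Rightarrow> 'a list. (\<forall>i<N. b i \<in> tuples M m) \<and>
          (\<forall>i j :: nat. i < N \<longrightarrow> 1 \<le> j \<longrightarrow> real j \<le> real N / real n \<longrightarrow>
             (b i, b ((i + j) mod N)) \<in> R))"
  show "NSOP n L M"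
    unfolding NSOP_def
  proof (rule notI, elim exE conjE)
    fix m R and a :: "nat \<Rightarrow> 'a list"
    assume R: "definable_rel L M m R"
      and a: "\<forall>i. a i \<in> tuples M m" "\<forall>i j. i < j \<longrightarrow> (a i, a j) \<in> R"
      and none: "\<nexists>a. (\<forall>i<n. a i \<in> tuples M m) \<and> (\<forall>i<n. (a i, a ((i + 1) mod n)) \<in> R)"
    have "\<exists>a :: nat \<Rightarrow> 'a list. (\<forall>i. a i \<in> tuples M m) \<and> (\<forall>i j. i < j \<longrightarrow> (a i, a j) \<in> R)"
      using a by (intro exI[of _ a]) simp
    from cyc[THEN spec, THEN spec, THEN mp, OF R, THEN mp, OF this, THEN spec, of n]
    obtain b where b: "\<forall>i<n. b i \<in> tuples M m"
      "\<forall>i j :: nat. i < n \<longrightarrow> 1 \<le> j \<longrightarrow> real j \<le> real n / real n \<longrightarrow> (b i, b ((i + j) mod n)) \<in> R"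
      by (elim exE conjE)
    have "(b i, b ((i + 1) mod n)) \<in> R" if "i < n" for i
      using b(2)[rule_format, of i 1] that assms(1) by simp
    then show False using none b(1) by blast
  qed
qed

end
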